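(* Let $\Bbbk$ be an algebraically closed field of characteristic zero, $q\in\Bbbk$ nonzero and not a root of unity, $R=\Bbbk\langle x,y:yx=qxy+1\rangle$, $\mu\in\Bbbk^*$, and $\sigma$ the automorphism of $R$ with $\sigma(x)=\mu^{-1}x$, $\sigma(y)=\mu y$. Let $h=1-yx\in R$ and let $f(h)\in\Bbbk[h]$. If $\delta$ is the $\sigma$-derivation of $R$ given on generators by $$\delta(x)=f(h)x,\qquad \delta(y)=\mu^{-1}f(q^{-1}h)y,$$ then $\delta$ commutes with any automorphism of $R$.
   Context: A $\sigma$-derivation of $R$ is a $\Bbbk$-linear map $\delta:R\to R$ with $\delta(ab)=\delta(a)b+\sigma(a)\delta(b)$ for all $a,b\in R$. Since $q$ is not a root of unity, every automorphism of $R$ has the form $\rho(x)=\beta^{-1}x$, $\rho(y)=\beta y$ with $\beta\in\Bbbk^*$. *)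

theory Defs
  imports
    "HOL-Library.Poly_Mapping"
    "HOL-Computational_Algebra.Polynomial"
    "HOL-Algebra.QuotRing"
begin

section \<open>The free algebra on two generators\<close>

datatype letter = X | Y

datatype word = Word (letters: "letter list")

text \<open>
  The free monoid on two letters. It is written additively because the convolution product on
  \<^typ>\<open>'a \<Rightarrow>\<^sub>0 'b\<close> uses the additive structure of \<^typ>\<open>'a\<close>; hence \<^typ>\<open>word \<Rightarrow>\<^sub>0 'k\<close> is
  the free associative algebra over \<^typ>\<open>'k\<close> on the two letters.
\<close>

instantiation word :: monoid_add
begin

definition zero_word :: word
  where "0 = Word []"

definition plus_word :: "word \<Rightarrow> word \<Rightarrow> word"
  where "u + v = Word (letters u @ letters v)"

instance
  by standard (simp_all add: zero_word_def plus_word_def)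

end

definition free_gen :: "letter \<Rightarrow> word \<Rightarrow>\<^sub>0 'k::field"
  where "free_gen a = Poly_Mapping.single (Word [a]) 1"

definition free_scalar :: "'k::field \<Rightarrow> word \<Rightarrow>\<^sub>0 'k"
  where "free_scalar c = Poly_Mapping.single 0 c"

definition free_algebra :: "(word \<Rightarrow>\<^sub>0 'k::field) ring"
  where "free_algebra = \<lparr>carrier = UNIV, mult = (*), one = 1, zero = 0, add = (+)\<rparr>"

lemma ring_free_algebra: "ring (free_algebra :: (word \<Rightarrow>\<^sub>0 'k::field) ring)"
proof (rule ringI)
  show "abelian_group (free_algebra :: (word \<Rightarrow>\<^sub>0 'k) ring)"
  proof (rule abelian_groupI)
    fix p :: "word \<Rightarrow>\<^sub>0 'k"
    show "\<exists>r\<in>carrier free_algebra. r \<oplus>\<^bsub>free_algebra\<^esub> p = \<zero>\<^bsub>free_algebra\<^esub>"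
      by (rule bexI[of _ "- p"]) (simp_all add: free_algebra_def)
  qed (simp_all add: free_algebra_def algebra_simps)
  show "Group.monoid (free_algebra :: (word \<Rightarrow>\<^sub>0 'k) ring)"
    by unfold_locales (simp_all add: free_algebra_def algebra_simps)
qed (simp_all add: free_algebra_def algebra_simps)


section \<open>The quantum Weyl algebra\<close>

definition weyl_relator :: "'k::field \<Rightarrow> word \<Rightarrow>\<^sub>0 'k"
  where "weyl_relator q =
    free_gen Y * free_gen X - (free_scalar q * (free_gen X * free_gen Y) + 1)"

definition weyl_ideal :: "'k::field \<Rightarrow> (word \<Rightarrow>\<^sub>0 'k) set"
  where "weyl_ideal q = Idl\<^bsub>free_algebra\<^esub> {weyl_relator q}"

definition qweyl :: "'k::field \<Rightarrow> (word \<Rightarrow>\<^sub>0 'k) set ring"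
  where "qweyl q = free_algebra Quot (weyl_ideal q)"

definition weyl_class :: "'k::field \<Rightarrow> (word \<Rightarrow>\<^sub>0 'k) \<Rightarrow> (word \<Rightarrow>\<^sub>0 'k) set"
  where "weyl_class q p = weyl_ideal q +>\<^bsub>free_algebra\<^esub> p"

definition weyl_x :: "'k::field \<Rightarrow> (word \<Rightarrow>\<^sub>0 'k) set"
  where "weyl_x q = weyl_class q (free_gen X)"

definition weyl_y :: "'k::field \<Rightarrow> (word \<Rightarrow>\<^sub>0 'k) set"
  where "weyl_y q = weyl_class q (free_gen Y)"

definition weyl_smult :: "'k::field \<Rightarrow> 'k \<Rightarrow> (word \<Rightarrow>\<^sub>0 'k) set \<Rightarrow> (word \<Rightarrow>\<^sub>0 'k) set"
  where "weyl_smult q c a = weyl_class q (free_scalar c) \<otimes>\<^bsub>qweyl q\<^esub> a"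

lemma ideal_weyl_ideal: "ideal (weyl_ideal q) free_algebra"
  unfolding weyl_ideal_def
  by (rule ring.genideal_ideal[OF ring_free_algebra]) (simp add: free_algebra_def)

lemma ring_qweyl: "ring (qweyl q)"
  unfolding qweyl_def by (rule ideal.quotient_is_ring[OF ideal_weyl_ideal])

lemma weyl_class_ring_hom: "weyl_class q \<in> ring_hom free_algebra (qweyl q)"
  using ideal.rcos_ring_hom[OF ideal_weyl_ideal, of q]
  by (simp add: weyl_class_def[abs_def] qweyl_def)

lemma weyl_relation:
  "weyl_y q \<otimes>\<^bsub>qweyl q\<^esub> weyl_x q =
    weyl_smult q q (weyl_x q \<otimes>\<^bsub>qweyl q\<^esub> weyl_y q) \<oplus>\<^bsub>qweyl q\<^esub> \<one>\<^bsub>qweyl q\<^esub>"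
proof -
  have hom: "weyl_class q (a * b) = weyl_class q a \<otimes>\<^bsub>qweyl q\<^esub> weyl_class q b"
    "weyl_class q (a + b) = weyl_class q a \<oplus>\<^bsub>qweyl q\<^esub> weyl_class q b"
    "weyl_class q 1 = \<one>\<^bsub>qweyl q\<^esub>" for a b
    using weyl_class_ring_hom[of q] by (auto simp: ring_hom_def free_algebra_def)
  have "weyl_relator q \<in> weyl_ideal q"
    unfolding weyl_ideal_def
    using ring.genideal_self[OF ring_free_algebra, of "{weyl_relator q}"]
    by (simp add: free_algebra_def)
  then have "weyl_class q (weyl_relator q) = \<zero>\<^bsub>qweyl q\<^esub>"
    using ideal.Icarr[OF ideal_weyl_ideal] ring.ring_simprules
      abelian_subgroup.a_rcos_const[OF ideal.axioms(1)[OF ideal_weyl_ideal,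
        THEN abelian_subgroupI3, OF ring.is_abelian_group[OF ring_free_algebra]]]
    by (simp add: weyl_class_def qweyl_def FactRing_def)
  moreover have "weyl_class q p \<in> carrier (qweyl q)" for p
    using weyl_class_ring_hom[of q] by (auto simp: ring_hom_def free_algebra_def)
  moreover have "free_gen Y * free_gen X =
      weyl_relator q + (free_scalar q * (free_gen X * free_gen Y) + 1)"
    by (simp add: weyl_relator_def)
  then have "weyl_class q (free_gen Y * free_gen X) =
      weyl_class q (weyl_relator q) \<oplus>\<^bsub>qweyl q\<^esub>
      weyl_class q (free_scalar q * (free_gen X * free_gen Y) + 1)"
    by (simp only: hom)
  ultimately have "weyl_class q (free_gen Y * free_gen X) =
      weyl_class q (free_scalar q * (free_gen X * free_gen Y) + 1)"
    by (simp add: abelian_monoid.l_zero[OF abelian_group.axioms(1)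
        [OF ring.is_abelian_group[OF ring_qweyl]]])
  then show ?thesis
    by (simp only: hom weyl_x_def weyl_y_def weyl_smult_def)
qed

definition weyl_h :: "'k::field \<Rightarrow> (word \<Rightarrow>\<^sub>0 'k) set"
  where "weyl_h q = \<one>\<^bsub>qweyl q\<^esub> \<ominus>\<^bsub>qweyl q\<^esub> (weyl_y q \<otimes>\<^bsub>qweyl q\<^esub> weyl_x q)"

text \<open>Evaluation of a polynomial in one variable over \<^typ>\<open>'k\<close> at an element of the algebra.\<close>

definition weyl_poly :: "'k::field \<Rightarrow> 'k poly \<Rightarrow> (word \<Rightarrow>\<^sub>0 'k) set \<Rightarrow> (word \<Rightarrow>\<^sub>0 'k) set"
  where "weyl_poly q f a =
    (\<Oplus>\<^bsub>qweyl q\<^esub> i\<in>{..degree f}. weyl_smult q (coeff f i) (a [^]\<^bsub>qweyl q\<^esub> i))"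


section \<open>Automorphisms and skew derivations\<close>

text \<open>
  Maps are total functions on the underlying type; only their values on the carrier are constrained.
\<close>

definition weyl_linear ::
    "'k::field \<Rightarrow> ((word \<Rightarrow>\<^sub>0 'k) set \<Rightarrow> (word \<Rightarrow>\<^sub>0 'k) set) \<Rightarrow> bool"
  where "weyl_linear q \<phi> \<longleftrightarrow>
    \<phi> \<in> carrier (qweyl q) \<rightarrow> carrier (qweyl q) \<and>
    (\<forall>a\<in>carrier (qweyl q). \<forall>b\<in>carrier (qweyl q).
      \<phi> (a \<oplus>\<^bsub>qweyl q\<^esub> b) = \<phi> a \<oplus>\<^bsub>qweyl q\<^esub> \<phi> b) \<and>
    (\<forall>c. \<forall>a\<in>carrier (qweyl q). \<phi> (weyl_smult q c a) = weyl_smult q c (\<phi> a))"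

definition weyl_automorphism ::
    "'k::field \<Rightarrow> ((word \<Rightarrow>\<^sub>0 'k) set \<Rightarrow> (word \<Rightarrow>\<^sub>0 'k) set) \<Rightarrow> bool"
  where "weyl_automorphism q \<rho> \<longleftrightarrow> \<rho> \<in> ring_iso (qweyl q) (qweyl q) \<and> weyl_linear q \<rho>"

definition weyl_skew_derivation ::
    "'k::field \<Rightarrow> ((word \<Rightarrow>\<^sub>0 'k) set \<Rightarrow> (word \<Rightarrow>\<^sub>0 'k) set) \<Rightarrow>
      ((word \<Rightarrow>\<^sub>0 'k) set \<Rightarrow> (word \<Rightarrow>\<^sub>0 'k) set) \<Rightarrow> bool"
  where "weyl_skew_derivation q \<sigma> \<delta> \<longleftrightarrow>
    weyl_linear q \<delta> \<and>
    (\<forall>a\<in>carrier (qweyl q). \<forall>b\<in>carrier (qweyl q).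
      \<delta> (a \<otimes>\<^bsub>qweyl q\<^esub> b) =
        (\<delta> a \<otimes>\<^bsub>qweyl q\<^esub> b) \<oplus>\<^bsub>qweyl q\<^esub> (\<sigma> a \<otimes>\<^bsub>qweyl q\<^esub> \<delta> b))"

end

theory Submission
  imports Defs
begin

text \<open>
  Since \<open>\<sigma>\<close>, \<open>\<rho>\<close> and \<open>\<delta>\<close> are determined by their values on x and y, it suffices to know that
  \<open>\<rho>\<close> rescales x and y by inverse factors: then \<open>\<rho>\<close> fixes yx, hence h and every polynomial in h.

  To determine \<open>\<rho>\<close>, let z = yx - xy, so that zx = q xz and yz = q zy. The quotient by z is
  commutative, so z generates the commutator ideal, whence \<open>\<rho>(z) = zu\<close> with u a unit. The algebra
  acts faithfully on Laurent polynomials in t, with x acting as multiplication by t and y as the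
  q-derivative; this grades it by weight, every homogeneous component acts on t^m by a polynomial
  in q^m, and leading terms show that units are scalars. Applying \<open>\<rho>\<close> to zx = q xz and yz = q zy
  then forces \<open>\<rho>(x)\<close> and \<open>\<rho>(y)\<close> to be homogeneous of weights 1 and -1, and z = (q - 1) xy + 1
  forces their polynomials to be those of scalar multiples of x and y.
\<close>

section \<open>The free algebra: monomials, scalars and induction\<close>

lemma word_plus [simp]: "Word u + Word v = Word (u @ v)"
  by (simp add: plus_word_def)

lemma poly_mapping_sum_singles:
  fixes p :: "'a \<Rightarrow>\<^sub>0 'b::comm_monoid_add"
  shows "(\<Sum>k\<in>Poly_Mapping.keys p. Poly_Mapping.single k (Poly_Mapping.lookup p k)) = p"
  by (rule poly_mapping_eqI) (simp add: lookup_sum lookup_single when_def in_keys_iff)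

text \<open>The last premise concerns only the terms of \<open>p\<close> itself, so the principle
  also serves for elements supported on a restricted set of words.\<close>

lemma poly_mapping_sum_singles_closed:
  fixes p :: "'a \<Rightarrow>\<^sub>0 'b::comm_monoid_add"
  assumes "P 0" "\<And>p p'. P p \<Longrightarrow> P p' \<Longrightarrow> P (p + p')"
    and "\<And>k. k \<in> Poly_Mapping.keys p \<Longrightarrow> P (Poly_Mapping.single k (Poly_Mapping.lookup p k))"
  shows "P p"
proof -
  have "P (\<Sum>k\<in>S. Poly_Mapping.single k (Poly_Mapping.lookup p k))"
    if "S \<subseteq> Poly_Mapping.keys p" for S
    using finite_subset[OF that finite_keys] that
    by (induction S rule: finite_induct) (auto intro: assms)
  from this[of "Poly_Mapping.keys p"] show ?thesis by (simp add: poly_mapping_sum_singles)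
qed

lemma free_scalar_mult_single:
  "free_scalar c * Poly_Mapping.single k d = Poly_Mapping.single k (c * d)"
  by (simp add: free_scalar_def mult_single)

lemma free_scalar_mult: "free_scalar c * free_scalar d = free_scalar (c * d)"
  by (simp add: free_scalar_def mult_single)

lemma free_scalar_mult_left: "free_scalar c * (free_scalar d * p) = free_scalar (c * d) * p"
  by (simp add: free_scalar_mult mult.assoc [symmetric])

lemma free_scalar_0 [simp]: "free_scalar 0 = 0"
  by (simp add: free_scalar_def)

lemma free_scalar_1 [simp]: "free_scalar 1 = 1"
  by (simp add: free_scalar_def)

lemma free_scalar_central: "p * free_scalar c = free_scalar c * p"
  by (rule poly_mapping_sum_singles_closed[where p = p])
    (simp_all add: algebra_simps free_scalar_def mult_single)

lemma free_scalar_central_left: "p * (free_scalar c * r) = free_scalar c * (p * r)"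
  by (metis free_scalar_central mult.assoc)

text \<open>Every word arises from the empty one by prepending letters, so left multiplication by
  generators and linear combinations, starting from \<open>1\<close>, reach everything.\<close>

lemma free_algebra_induct [case_names one gen add scalar]:
  assumes "P 1" "\<And>a p. P p \<Longrightarrow> P (free_gen a * p)"
    and "\<And>p p'. P p \<Longrightarrow> P p' \<Longrightarrow> P (p + p')" "\<And>c p. P p \<Longrightarrow> P (free_scalar c * p)"
  shows "P p"
proof (rule poly_mapping_sum_singles_closed[where p = p])
  show "P 0" using assms(4)[OF assms(1), of 0] by simp
  fix k
  have "P (Poly_Mapping.single (Word l) 1)" for l
  proof (induction l)
    case Nil
    then show ?case using assms(1) by (simp add: zero_word_def[symmetric])
  next
    case (Cons a l)
    then show ?case using assms(2)[of _ a] by (force simp: free_gen_def mult_single)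
  qed
  then have "P (Poly_Mapping.single k 1)" by (cases k) simp
  from assms(4)[OF this] show "P (Poly_Mapping.single k (Poly_Mapping.lookup p k))"
    by (simp add: free_scalar_mult_single)
qed (rule assms(3))

section \<open>Computing in the quotient with representatives\<close>

lemma weyl_class_add: "weyl_class q (a + b) = weyl_class q a \<oplus>\<^bsub>qweyl q\<^esub> weyl_class q b"
  and weyl_class_mult: "weyl_class q (a * b) = weyl_class q a \<otimes>\<^bsub>qweyl q\<^esub> weyl_class q b"
  and weyl_class_one: "weyl_class q 1 = \<one>\<^bsub>qweyl q\<^esub>"
  and weyl_class_closed [simp]: "weyl_class q a \<in> carrier (qweyl q)"
  using weyl_class_ring_hom[of q] by (auto simp: ring_hom_def free_algebra_def)

lemma weyl_class_smult: "weyl_class q (free_scalar c * a) = weyl_smult q c (weyl_class q a)"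
  by (simp add: weyl_smult_def weyl_class_mult)

lemma weyl_class_minus: "weyl_class q (a - b) = weyl_class q a \<ominus>\<^bsub>qweyl q\<^esub> weyl_class q b"
proof -
  interpret R: ring "qweyl q" by (rule ring_qweyl)
  have "weyl_class q (a - b) \<oplus>\<^bsub>qweyl q\<^esub> weyl_class q b = weyl_class q a"
    by (simp flip: weyl_class_add)
  then show ?thesis
    by (metis R.add.inv_solve_right R.minus_eq weyl_class_closed)
qed

lemma weyl_class_cases:
  assumes "a \<in> carrier (qweyl q)"
  obtains p where "a = weyl_class q p"
  using assms by (auto simp: qweyl_def FactRing_def A_RCOSETS_def RCOSETS_def weyl_class_def a_r_coset_def)

lemma weyl_class_eqD:
  assumes "weyl_class q a = weyl_class q b"
  shows "a - b \<in> weyl_ideal q"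
proof -
  interpret I: ideal "weyl_ideal q" free_algebra by (rule ideal_weyl_ideal)
  have "a \<in> weyl_class q a"
    using I.a_rcos_self[of a] by (simp add: weyl_class_def free_algebra_def)
  then have "a \<in> weyl_class q b" using assms by simp
  then show ?thesis
    by (auto simp: weyl_class_def a_r_coset_def' free_algebra_def)
qed

lemma weyl_class_relation:
  "weyl_class q (free_gen Y * free_gen X) =
    weyl_class q (free_scalar q * (free_gen X * free_gen Y) + 1)"
  using weyl_relation[of q]
  by (simp only: weyl_class_mult weyl_class_add weyl_class_one weyl_x_def weyl_y_def weyl_smult_def)


section \<open>The action on Laurent polynomials\<close>

primrec letter_weight :: "letter \<Rightarrow> int"
  where "letter_weight X = 1" | "letter_weight Y = -1"

primrec weight :: "letter list \<Rightarrow> int"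
  where "weight [] = 0" | "weight (a # l) = letter_weight a + weight l"

text \<open>The q-number [m], for negative m as well: the q-derivative maps t^m to [m] t^(m -
  1).\<close>

definition q_int :: "'k::field \<Rightarrow> int \<Rightarrow> 'k"
  where "q_int q m = (q powi m - 1) / (q - 1)"

text \<open>
  The word l sends t^m to \<open>word_coeff q l m\<close> times t^(m + \<open>weight l\<close>), and \<open>weyl_rep q p i m\<close>
  is the coefficient of t^(m + i) in the image of t^m under p.
\<close>

primrec word_coeff :: "'k::field \<Rightarrow> letter list \<Rightarrow> int \<Rightarrow> 'k"
  where "word_coeff q [] m = 1"
  | "word_coeff q (a # l) m =
      (case a of X \<Rightarrow> 1 | Y \<Rightarrow> q_int q (m + weight l)) * word_coeff q l m"

definition weyl_rep :: "'k::field \<Rightarrow> (word \<Rightarrow>\<^sub>0 'k) \<Rightarrow> int \<Rightarrow> int \<Rightarrow> 'k"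
  where "weyl_rep q p i m = (\<Sum>w\<in>Poly_Mapping.keys p.
    Poly_Mapping.lookup p w * (if weight (letters w) = i then word_coeff q (letters w) m else 0))"

lemma weight_append [simp]: "weight (u @ v) = weight u + weight v"
  by (induction u) simp_all

lemma word_coeff_append:
  "word_coeff q (u @ v) m = word_coeff q u (m + weight v) * word_coeff q v m"
  by (induction u) (simp_all add: algebra_simps split: letter.split)

text \<open>Each letter changes the exponent by one, so a word leading from a nonnegative to a
  negative exponent must at some point apply y to t^0, and [0] = 0.\<close>

lemma word_coeff_preserves_nonneg:
  "0 \<le> m \<Longrightarrow> m + weight l < 0 \<Longrightarrow> word_coeff q l m = 0"
proof (induction l)
  case (Cons a l)
  show ?case
  proof (cases "m + weight l < 0")
    case False
    then have "a = Y" "m + weight l = 0"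
      using Cons.prems by (cases a; simp)+
    then show ?thesis by (simp add: q_int_def)
  qed (use Cons in simp)
qed simp

lemma weyl_rep_superset:
  assumes "finite S" "Poly_Mapping.keys p \<subseteq> S"
  shows "weyl_rep q p i m = (\<Sum>w\<in>S.
    Poly_Mapping.lookup p w * (if weight (letters w) = i then word_coeff q (letters w) m else 0))"
  unfolding weyl_rep_def using assms
  by (intro sum.mono_neutral_left) (auto simp: in_keys_iff)

lemma weyl_rep_zero [simp]: "weyl_rep q 0 i m = 0"
  by (simp add: weyl_rep_def)

lemma weyl_rep_add [simp]: "weyl_rep q (a + b) i m = weyl_rep q a i m + weyl_rep q b i m"
proof -
  have "Poly_Mapping.keys (a + b) \<subseteq> Poly_Mapping.keys a \<union> Poly_Mapping.keys b"
    by (rule keys_add)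
  then show ?thesis
    by (subst (1 2 3) weyl_rep_superset[of "Poly_Mapping.keys a \<union> Poly_Mapping.keys b"])
      (simp_all add: lookup_add sum.distrib distrib_right)
qed

lemma weyl_rep_diff [simp]: "weyl_rep q (a - b) i m = weyl_rep q a i m - weyl_rep q b i m"
  by (metis add_diff_cancel_right' diff_add_cancel weyl_rep_add)

lemma weyl_rep_single [simp]:
  "weyl_rep q (Poly_Mapping.single w c) i m =
    (if weight (letters w) = i then c * word_coeff q (letters w) m else 0)"
  by (simp add: weyl_rep_def)

lemma weyl_rep_sum: "weyl_rep q (sum g S) i m = (\<Sum>s\<in>S. weyl_rep q (g s) i m)"
  by (induction S rule: infinite_finite_induct) simp_all

lemma weyl_rep_gen_X [simp]: "weyl_rep q (free_gen X) i m = (if i = 1 then 1 else 0)"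
  and weyl_rep_gen_Y [simp]: "weyl_rep q (free_gen Y) i m = (if i = -1 then q_int q m else 0)"
  and weyl_rep_scalar [simp]: "weyl_rep q (free_scalar c) i m = (if i = 0 then c else 0)"
  and weyl_rep_one [simp]: "weyl_rep q 1 i m = (if i = 0 then 1 else 0)"
  by (auto simp: free_gen_def free_scalar_def zero_word_def simp flip: single_one)

lemma finite_weights: "finite {j. \<exists>m. weyl_rep q p j m \<noteq> 0}"
proof (rule finite_subset)
  show "{j. \<exists>m. weyl_rep q p j m \<noteq> 0} \<subseteq> (\<lambda>w. weight (letters w)) ` Poly_Mapping.keys p"
  proof
    fix j assume "j \<in> {j. \<exists>m. weyl_rep q p j m \<noteq> 0}"
    then obtain m where "weyl_rep q p j m \<noteq> 0" by blast
    then show "j \<in> (\<lambda>w. weight (letters w)) ` Poly_Mapping.keys p"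
      unfolding weyl_rep_def by (rule sum.not_neutral_contains_not_neutral) (auto split: if_splits)
  qed
qed simp

text \<open>Composition of graded operators. Both sides are bilinear, and for two words the formula
  is \<open>word_coeff_append\<close>, the weight of the right word being the only index that
  contributes.\<close>

lemma weyl_rep_mult_keys:
  assumes "finite J" "(\<lambda>w. weight (letters w)) ` Poly_Mapping.keys b \<subseteq> J"
  shows "weyl_rep q (a * b) i m =
    (\<Sum>j\<in>J. weyl_rep q a (i - j) (m + j) * weyl_rep q b j m)"
proof -
  let ?s = "\<lambda>p w. Poly_Mapping.single w (Poly_Mapping.lookup p w)"
  have *: "weyl_rep q (?s a v * ?s b w) i m =
      (\<Sum>j\<in>J. weyl_rep q (?s a v) (i - j) (m + j) * weyl_rep q (?s b w) j m)"
    if "w \<in> Poly_Mapping.keys b" for v w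
  proof -
    have "weight (letters w) \<in> J" using that assms(2) by auto
    then show ?thesis
      using assms(1)
      by (auto simp: mult_single plus_word_def word_coeff_append algebra_simps
          if_distrib[of "\<lambda>x. _ * x"] sum.delta cong: if_cong)
  qed
  have "weyl_rep q (a * b) i m =
      (\<Sum>v\<in>Poly_Mapping.keys a. \<Sum>w\<in>Poly_Mapping.keys b. weyl_rep q (?s a v * ?s b w) i m)"
    by (subst (1) poly_mapping_sum_singles[symmetric, of a],
        subst (1) poly_mapping_sum_singles[symmetric, of b])
      (simp add: sum_product weyl_rep_sum)
  also have "\<dots> = (\<Sum>v\<in>Poly_Mapping.keys a. \<Sum>w\<in>Poly_Mapping.keys b.
      (\<Sum>j\<in>J. weyl_rep q (?s a v) (i - j) (m + j) * weyl_rep q (?s b w) j m))"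
    using * by simp
  also have "\<dots> = (\<Sum>j\<in>J. (\<Sum>v\<in>Poly_Mapping.keys a. weyl_rep q (?s a v) (i - j) (m + j)) *
      (\<Sum>w\<in>Poly_Mapping.keys b. weyl_rep q (?s b w) j m))"
    by (simp only: sum_product sum.swap[of _ J "Poly_Mapping.keys a"]
        sum.swap[of _ J "Poly_Mapping.keys b"])
  also have "\<dots> = (\<Sum>j\<in>J. weyl_rep q a (i - j) (m + j) * weyl_rep q b j m)"
    by (simp only: weyl_rep_sum[symmetric] poly_mapping_sum_singles)
  finally show ?thesis .
qed

text \<open>Frees the index set from the support of \<open>b\<close>: it may shrink to a singleton
  for homogeneous factors, or to the empty set when a factor acts as zero.\<close>

lemma weyl_rep_mult:
  assumes "finite J" "\<And>j. j \<notin> J \<Longrightarrow> weyl_rep q b j m = 0 \<or> weyl_rep q a (i - j) (m + j) = 0"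
  shows "weyl_rep q (a * b) i m =
    (\<Sum>j\<in>J. weyl_rep q a (i - j) (m + j) * weyl_rep q b j m)"
proof -
  let ?K = "(\<lambda>w. weight (letters w)) ` Poly_Mapping.keys b"
  have "weyl_rep q (a * b) i m =
    (\<Sum>j\<in>?K \<union> J. weyl_rep q a (i - j) (m + j) * weyl_rep q b j m)"
    by (rule weyl_rep_mult_keys) (use assms in auto)
  also have "\<dots> = (\<Sum>j\<in>J. weyl_rep q a (i - j) (m + j) * weyl_rep q b j m)"
    by (rule sum.mono_neutral_right) (use assms in auto)
  finally show ?thesis .
qed

lemma weyl_rep_mult_hom_right:
  assumes "\<And>j. j \<noteq> d \<Longrightarrow> weyl_rep q b j m = 0"
  shows "weyl_rep q (a * b) i m = weyl_rep q a (i - d) (m + d) * weyl_rep q b d m"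
  by (subst weyl_rep_mult[of "{d}"]) (use assms in auto)

lemma weyl_rep_mult_hom_left:
  assumes "\<And>j m. j \<noteq> d \<Longrightarrow> weyl_rep q a j m = 0"
  shows "weyl_rep q (a * b) i m = weyl_rep q a d (m + i - d) * weyl_rep q b (i - d) m"
  by (subst weyl_rep_mult[of "{i - d}"]) (use assms in \<open>auto simp: algebra_simps\<close>)

lemma weyl_rep_scalar_mult [simp]:
  "weyl_rep q (free_scalar c * a) i m = c * weyl_rep q a i m"
  by (subst weyl_rep_mult_hom_left[of 0]) auto

lemma weyl_rep_preserves_nonneg: "0 \<le> m \<Longrightarrow> m + i < 0 \<Longrightarrow> weyl_rep q p i m = 0"
  unfolding weyl_rep_def by (rule sum.neutral) (auto simp: word_coeff_preserves_nonneg)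

text \<open>Along a word every x contributes the factor 1 and every y a q-number [m + d], with d
  determined by the letters to its right; such a factor is linear in q^m.\<close>

lemma weyl_rep_polynomial:
  assumes "q \<noteq> 0"
  shows "\<exists>g. \<forall>m. weyl_rep q p i m = poly g (q powi m)"
proof (rule poly_mapping_sum_singles_closed[where p = p])
  show "\<exists>g. \<forall>m. weyl_rep q 0 i m = poly g (q powi m)"
    by (rule exI[of _ 0]) simp
next
  fix a b
  assume "\<exists>g. \<forall>m. weyl_rep q a i m = poly g (q powi m)"
    and "\<exists>g. \<forall>m. weyl_rep q b i m = poly g (q powi m)"
  then show "\<exists>g. \<forall>m. weyl_rep q (a + b) i m = poly g (q powi m)"
    by (metis poly_add weyl_rep_add)
next
  fix w
  have "\<exists>g. \<forall>m. word_coeff q l m = poly g (q powi m)" for l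
  proof (induction l)
    case Nil
    show ?case by (rule exI[of _ 1]) simp
  next
    case (Cons a l)
    then obtain g where g: "\<And>m. word_coeff q l m = poly g (q powi m)" by blast
    show ?case
    proof (cases a)
      case X
      then show ?thesis using g by auto
    next
      case Y
      \<comment> \<open>With T standing for q^m, the left factor is (q^w T - 1) / (q - 1) for w =
        \<open>weight l\<close>.\<close>
      let ?h = "[: - (1 / (q - 1)), q powi weight l / (q - 1) :] * g"
      show ?thesis
        by (rule exI[of _ ?h])
          (simp add: g Y q_int_def power_int_add assms diff_divide_distrib algebra_simps)
    qed
  qed
  then obtain g where g: "\<And>m. word_coeff q (letters w) m = poly g (q powi m)" by blast
  show "\<exists>g. \<forall>m. weyl_rep q (Poly_Mapping.single w (Poly_Mapping.lookup p w)) i m =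
      poly g (q powi m)"
    by (rule exI[of _ "if weight (letters w) = i then smult (Poly_Mapping.lookup p w) g else 0"])
      (simp add: g)
qed

text \<open>On t^m the defining relation reads [m + 1] = q [m] + 1.\<close>

lemma weyl_rep_relator:
  assumes "q \<noteq> 0" "q \<noteq> 1"
  shows "weyl_rep q (weyl_relator q) i m = 0"
proof -
  have "q - 1 \<noteq> 0" using assms by simp
  then have "q_int q (m + 1) = q * q_int q m + 1"
    using assms by (simp add: q_int_def power_int_add field_simps)
  then show ?thesis
    by (simp add: weyl_relator_def weyl_rep_mult_hom_right[of 1] weyl_rep_mult_hom_right[of "-1"])
qed

text \<open>The elements that act as zero form a two-sided ideal containing the relator, hence
  containing the ideal it generates.\<close>

lemma weyl_rep_ideal:
  assumes "q \<noteq> 0" "q \<noteq> 1" "p \<in> weyl_ideal q"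
  shows "weyl_rep q p i m = 0"
proof -
  let ?K = "{p. \<forall>i m. weyl_rep q p i m = 0}"
  interpret F: ring "free_algebra :: (word \<Rightarrow>\<^sub>0 'a) ring" by (rule ring_free_algebra)
  have neg: "\<ominus>\<^bsub>free_algebra\<^esub> a = - a" for a :: "word \<Rightarrow>\<^sub>0 'a"
    by (rule F.minus_equality) (simp_all add: free_algebra_def)
  have "ideal ?K free_algebra"
  proof (rule idealI)
    show "ring (free_algebra :: (word \<Rightarrow>\<^sub>0 'a) ring)" by (rule ring_free_algebra)
    show "subgroup ?K (add_monoid free_algebra)"
    proof (rule F.add.subgroupI)
      fix a assume "a \<in> ?K"
      then have "- a \<in> ?K" using weyl_rep_diff[of q 0 a] by simp
      then show "\<ominus>\<^bsub>free_algebra\<^esub> a \<in> ?K" by (simp only: neg)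
    qed (auto simp: free_algebra_def intro: exI[of _ 0])
  next
    fix a x :: "word \<Rightarrow>\<^sub>0 'a" assume a: "a \<in> ?K"
    show "x \<otimes>\<^bsub>free_algebra\<^esub> a \<in> ?K" "a \<otimes>\<^bsub>free_algebra\<^esub> x \<in> ?K"
      using a weyl_rep_mult[of "{}" q] by (auto simp: free_algebra_def)
  qed
  then have "weyl_ideal q \<subseteq> ?K"
    unfolding weyl_ideal_def
    by (rule F.genideal_minimal) (simp add: weyl_rep_relator assms)
  with assms(3) show ?thesis by blast
qed

lemma weyl_rep_cong:
  assumes "q \<noteq> 0" "q \<noteq> 1" "weyl_class q a = weyl_class q b"
  shows "weyl_rep q a = weyl_rep q b"
  using weyl_rep_ideal[OF assms(1,2) weyl_class_eqD[OF assms(3)]] by (auto simp: fun_eq_iff)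


section \<open>Faithfulness and the normal element\<close>

locale generic_q =
  fixes q :: "'k::field"
  assumes q_nonzero: "q \<noteq> 0" and q_not_root: "\<And>n::nat. n > 0 \<Longrightarrow> q ^ n \<noteq> 1"
begin

lemma q_neq_1: "q \<noteq> 1"
  using q_not_root[of 1] by simp

lemma q_powi_eq_1_iff: "q powi m = 1 \<longleftrightarrow> m = 0"
proof
  assume *: "q powi m = 1"
  then have "q powi (- m) = 1" by (simp add: power_int_minus)
  with * have "q ^ nat \<bar>m\<bar> = 1"
    by (cases "m \<ge> 0") (simp_all flip: power_int_of_nat)
  then show "m = 0" using q_not_root[of "nat \<bar>m\<bar>"] by auto
qed simp

lemma q_powi_eq_iff: "q powi m = q powi n \<longleftrightarrow> m = n"
proof -
  have "q powi m = q powi n \<longleftrightarrow> q powi (m - n) = 1"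
    using q_nonzero by (simp add: power_int_diff)
  then show ?thesis by (simp add: q_powi_eq_1_iff)
qed

lemma q_int_eq_0_iff: "q_int q m = 0 \<longleftrightarrow> m = 0"
  using q_neq_1 by (simp add: q_int_def q_powi_eq_1_iff)

text \<open>The powers of q are pairwise distinct, so a nonzero difference would have infinitely
  many roots.\<close>

lemma poly_eqI_q_powi:
  assumes "\<And>m. poly g (q powi m) = poly h (q powi m)"
  shows "g = h"
proof (rule ccontr)
  assume "g \<noteq> h"
  then have "finite {x. poly (g - h) x = 0}" by (intro poly_roots_finite) simp
  moreover have "range (\<lambda>m. q powi m) \<subseteq> {x. poly (g - h) x = 0}" using assms by auto
  ultimately have "finite (range (\<lambda>m. q powi m))" by (rule finite_subset[rotated])
  moreover have "inj (\<lambda>m. q powi m)" by (simp add: inj_def q_powi_eq_iff)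
  ultimately have "finite (UNIV :: int set)" by (rule finite_imageD)
  then show False by simp
qed

lemma weyl_rep_shift_polynomial: "\<exists>g. \<forall>m. weyl_rep q p i (m + d) = poly g (q powi m)"
proof -
  obtain g where g: "\<And>m. weyl_rep q p i m = poly g (q powi m)"
    using weyl_rep_polynomial[OF q_nonzero] by blast
  show ?thesis
    by (rule exI[of _ "pcompose g [:0, q powi d:]"])
      (simp add: g poly_pcompose power_int_add q_nonzero mult.commute)
qed

section \<open>Ordered monomials x^i y^j and faithfulness of the action\<close>

definition sorted_words :: "word set"
  where "sorted_words = {w. \<exists>i j. w = Word (replicate i X @ replicate j Y)}"

lemma sorted_wordsI: "Word (replicate i X @ replicate j Y) \<in> sorted_words"
  by (auto simp: sorted_words_def)

definition sorted_representable :: "(word \<Rightarrow>\<^sub>0 'k) \<Rightarrow> bool"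
  where "sorted_representable p \<longleftrightarrow>
    (\<exists>p'. Poly_Mapping.keys p' \<subseteq> sorted_words \<and> weyl_class q p = weyl_class q p')"

lemma sorted_representable_cong:
  "weyl_class q a = weyl_class q b \<Longrightarrow> sorted_representable a \<longleftrightarrow> sorted_representable b"
  by (simp add: sorted_representable_def)

lemma sorted_representable_sorted:
  "Poly_Mapping.keys p \<subseteq> sorted_words \<Longrightarrow> sorted_representable p"
  by (auto simp: sorted_representable_def)

lemma sorted_representable_add:
  assumes "sorted_representable a" "sorted_representable b"
  shows "sorted_representable (a + b)"
proof -
  obtain a' b' where *: "Poly_Mapping.keys a' \<subseteq> sorted_words" "weyl_class q a = weyl_class q a'"
    "Poly_Mapping.keys b' \<subseteq> sorted_words" "weyl_class q b = weyl_class q b'"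
    using assms by (auto simp: sorted_representable_def)
  then have "weyl_class q (a + b) = weyl_class q (a' + b')"
    by (simp add: weyl_class_add)
  with * keys_add[of a' b'] show ?thesis
    unfolding sorted_representable_def by (intro exI[of _ "a' + b'"]) auto
qed

lemma sorted_representable_scalar:
  assumes "sorted_representable a"
  shows "sorted_representable (free_scalar c * a)"
proof -
  obtain a' where *: "Poly_Mapping.keys a' \<subseteq> sorted_words" "weyl_class q a = weyl_class q a'"
    using assms by (auto simp: sorted_representable_def)
  have "Poly_Mapping.keys (free_scalar c * a') \<subseteq> Poly_Mapping.keys a'"
    using keys_mult[of "free_scalar c" a'] by (force simp: free_scalar_def split: if_splits)
  with * show ?thesis
    unfolding sorted_representable_def
    by (intro exI[of _ "free_scalar c * a'"]) (auto simp: weyl_class_mult)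
qed

lemma sorted_representable_X:
  assumes "sorted_representable a"
  shows "sorted_representable (free_gen X * a)"
proof -
  obtain a' where *: "Poly_Mapping.keys a' \<subseteq> sorted_words" "weyl_class q a = weyl_class q a'"
    using assms by (auto simp: sorted_representable_def)
  have "Word [X] + w \<in> sorted_words" if "w \<in> sorted_words" for w
  proof -
    from that obtain i j where "w = Word (replicate i X @ replicate j Y)"
      by (auto simp: sorted_words_def)
    then have "Word [X] + w = Word (replicate (Suc i) X @ replicate j Y)" by simp
    then show ?thesis unfolding sorted_words_def by blast
  qed
  then have "Poly_Mapping.keys (free_gen X * a') \<subseteq> sorted_words"
    using keys_mult[of "free_gen X" a'] *(1) by (force simp: free_gen_def)
  with * show ?thesis
    unfolding sorted_representable_def
    by (intro exI[of _ "free_gen X * a'"]) (auto simp: weyl_class_mult)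
qed

text \<open>Induction on \<open>i\<close> moves y past the leading x by yx = q xy + 1. The first
  term is a multiple of x times the previous case, the second already has its letters in
  order.\<close>

lemma sorted_representable_Y_monomial:
  "sorted_representable
    (free_gen Y * Poly_Mapping.single (Word (replicate i X @ replicate j Y)) c)"
proof (induction i)
  case 0
  have "Word (replicate (Suc j) Y) \<in> sorted_words"
    using sorted_wordsI[of 0 "Suc j"] by simp
  then show ?case
    by (intro sorted_representable_sorted) (simp add: free_gen_def mult_single)
next
  case (Suc i)
  let ?m = "Poly_Mapping.single (Word (replicate i X @ replicate j Y)) c"
  have "weyl_class q (free_gen Y * (free_gen X * ?m)) =
      weyl_class q (free_gen Y * free_gen X) \<otimes>\<^bsub>qweyl q\<^esub> weyl_class q ?m"
    by (simp flip: weyl_class_mult add: mult.assoc)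
  also have "\<dots> = weyl_class q ((free_scalar q * (free_gen X * free_gen Y) + 1) * ?m)"
    by (simp only: weyl_class_relation
        weyl_class_mult[of q "free_scalar q * (free_gen X * free_gen Y) + 1"])
  also have "(free_scalar q * (free_gen X * free_gen Y) + 1) * ?m =
      free_scalar q * (free_gen X * (free_gen Y * ?m)) + ?m"
    by (simp add: algebra_simps)
  finally have eq: "weyl_class q (free_gen Y * (free_gen X * ?m)) =
      weyl_class q (free_scalar q * (free_gen X * (free_gen Y * ?m)) + ?m)" .
  have "sorted_representable ?m"
    by (rule sorted_representable_sorted) (auto simp: sorted_words_def)
  then have "sorted_representable (free_scalar q * (free_gen X * (free_gen Y * ?m)) + ?m)"
    using Suc by (intro sorted_representable_add sorted_representable_scalar sorted_representable_X)
  then have "sorted_representable (free_gen Y * (free_gen X * ?m))"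
    by (rule iffD2[OF sorted_representable_cong[OF eq]])
  moreover have "free_gen X * ?m =
      Poly_Mapping.single (Word (replicate (Suc i) X @ replicate j Y)) c"
    by (simp add: free_gen_def mult_single)
  ultimately show ?case by simp
qed

lemma sorted_representable_Y:
  assumes "sorted_representable a"
  shows "sorted_representable (free_gen Y * a)"
proof -
  obtain a' where *: "Poly_Mapping.keys a' \<subseteq> sorted_words" "weyl_class q a = weyl_class q a'"
    using assms by (auto simp: sorted_representable_def)
  have "sorted_representable (free_gen Y * a')"
  proof (rule poly_mapping_sum_singles_closed[where p = a'])
    show "sorted_representable (free_gen Y * 0)"
      by (rule sorted_representable_sorted) simp
    fix k assume "k \<in> Poly_Mapping.keys a'"
    with *(1) obtain i j where "k = Word (replicate i X @ replicate j Y)"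
      by (auto simp: sorted_words_def)
    then show "sorted_representable
        (free_gen Y * Poly_Mapping.single k (Poly_Mapping.lookup a' k))"
      by (simp only: sorted_representable_Y_monomial)
  qed (simp add: distrib_left sorted_representable_add)
  moreover have "weyl_class q (free_gen Y * a) = weyl_class q (free_gen Y * a')"
    using *(2) by (simp add: weyl_class_mult)
  ultimately show ?thesis by (metis sorted_representable_cong)
qed

lemma sorted_representable_all: "sorted_representable p"
proof (induction p rule: free_algebra_induct)
  case one
  have "0 \<in> sorted_words"
    using sorted_wordsI[of 0 0] by (simp add: zero_word_def)
  then show ?case by (intro sorted_representable_sorted) simp
next
  case (gen a p)
  then show ?case
    by (cases a) (simp_all add: sorted_representable_X sorted_representable_Y)
qed (simp_all add: sorted_representable_add sorted_representable_scalar)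

lemma weight_replicate [simp]: "weight (replicate n a) = int n * letter_weight a"
  by (induction n) (simp_all add: algebra_simps)

lemma word_coeff_replicate_X [simp]: "word_coeff q (replicate n X) m = 1"
  by (induction n) simp_all

text \<open>The coefficient is [m] [m - 1] ... [m - n + 1], and [k] vanishes only for k = 0.\<close>

lemma word_coeff_replicate_Y:
  "word_coeff q (replicate n Y) m = 0 \<longleftrightarrow> 0 \<le> m \<and> m < int n"
  by (induction n) (auto simp: q_int_eq_0_iff)

text \<open>
  The least power of y occurring in a combination of monomials x^i y^j is detected by its
  action on the same power of t, which all higher powers of y annihilate.
\<close>

lemma sorted_eq_0:
  assumes "Poly_Mapping.keys p \<subseteq> sorted_words" "\<And>i m. weyl_rep q p i m = 0"
  shows "p = 0"
proof (rule ccontr)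
  assume "p \<noteq> 0"
  define mon where "mon i j = Word (replicate i X @ replicate j Y)" for i j
  have "\<exists>j i. mon i j \<in> Poly_Mapping.keys p"
  proof -
    from \<open>p \<noteq> 0\<close> obtain w where "w \<in> Poly_Mapping.keys p" by (metis keys_eq_empty ex_in_conv)
    moreover then obtain i j where "w = mon i j"
      using assms(1) by (auto simp: mon_def sorted_words_def)
    ultimately show ?thesis by blast
  qed
  note ex = this
  define j where "j = (LEAST j. \<exists>i. mon i j \<in> Poly_Mapping.keys p)"
  have "\<exists>i. mon i j \<in> Poly_Mapping.keys p"
    unfolding j_def using ex by (rule LeastI_ex)
  have least: "mon i' j' \<notin> Poly_Mapping.keys p" if "j' < j" for i' j'
    using not_less_Least[of j' "\<lambda>j. \<exists>i. mon i j \<in> Poly_Mapping.keys p"] that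
    by (auto simp: j_def)
  from \<open>\<exists>i. mon i j \<in> Poly_Mapping.keys p\<close> obtain i where i: "mon i j \<in> Poly_Mapping.keys p" by blast
  \<comment> \<open>The test is the component of weight i - j on t^j. Within this weight the power
    of y determines that of x, so by minimality every other monomial present has more than j factors
    y.\<close>
  let ?f = "\<lambda>w. Poly_Mapping.lookup p w *
    (if weight (letters w) = int i - int j then word_coeff q (letters w) (int j) else 0)"
  have "?f w = 0" if "w \<in> Poly_Mapping.keys p" "w \<noteq> mon i j" for w
  proof (cases "weight (letters w) = int i - int j")
    case True
    from that(1) obtain i' j' where w: "w = mon i' j'"
      using assms(1) by (auto simp: mon_def sorted_words_def)
    with True have "int i' - int j' = int i - int j" by (simp add: mon_def)
    moreover have "j' \<ge> j" using least that(1) w by (meson not_le)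
    moreover have "i' \<noteq> i \<or> j' \<noteq> j" using that(2) w by auto
    ultimately have "j < j'" by auto
    then have "word_coeff q (letters w) (int j) = 0"
      by (simp add: w mon_def word_coeff_append word_coeff_replicate_Y)
    then show ?thesis by simp
  qed simp
  then have "weyl_rep q p (int i - int j) (int j) = (\<Sum>w\<in>{mon i j}. ?f w)"
    unfolding weyl_rep_def using i by (intro sum.mono_neutral_right) auto
  moreover have "?f (mon i j) \<noteq> 0"
    using i by (simp add: mon_def word_coeff_append word_coeff_replicate_Y in_keys_iff)
  ultimately show False using assms(2) by simp
qed

text \<open>Faithfulness: a - b is congruent to a combination of ordered monomials which acts as
  zero and therefore vanishes. Identities in the quotient can now be checked on the powers of
  t.\<close>

lemma weyl_class_eq_iff: "weyl_class q a = weyl_class q b \<longleftrightarrow> weyl_rep q a = weyl_rep q b"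
proof
  assume eq: "weyl_rep q a = weyl_rep q b"
  obtain p where p: "Poly_Mapping.keys p \<subseteq> sorted_words"
    "weyl_class q (a - b) = weyl_class q p"
    using sorted_representable_all[of "a - b"] by (auto simp: sorted_representable_def)
  have "weyl_rep q p i m = 0" for i m
    using eq by (simp flip: weyl_rep_cong[OF q_nonzero q_neq_1 p(2)])
  with p(1) have "p = 0" by (rule sorted_eq_0)
  then have "weyl_class q (a - b + b) = weyl_class q (0 + b)"
    using p(2) by (simp only: weyl_class_add)
  then show "weyl_class q a = weyl_class q b" by simp
qed (rule weyl_rep_cong[OF q_nonzero q_neq_1])

lemma weyl_class_eqI:
  "(\<And>i m. weyl_rep q a i m = weyl_rep q b i m) \<Longrightarrow> weyl_class q a = weyl_class q b"
  by (simp add: weyl_class_eq_iff fun_eq_iff)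

section \<open>The normal element z and its multiples\<close>

definition weyl_z :: "word \<Rightarrow>\<^sub>0 'k"
  where "weyl_z = free_gen Y * free_gen X - free_gen X * free_gen Y"

text \<open>Since [m + 1] - [m] = q^m. Thus z acts diagonally with nonzero entries and can be
  cancelled.\<close>

lemma weyl_rep_z [simp]: "weyl_rep q weyl_z i m = (if i = 0 then q powi m else 0)"
proof -
  have "(q powi (m + 1) - 1) - (q powi m - 1) = q powi m * (q - 1)"
    using q_nonzero by (simp add: power_int_add algebra_simps)
  then have "q_int q (m + 1) - q_int q m = q powi m"
    using q_neq_1 by (simp add: q_int_def flip: diff_divide_distrib)
  then show ?thesis
    by (simp add: weyl_z_def weyl_rep_mult_hom_right[of 1] weyl_rep_mult_hom_right[of "-1"])
qed

lemma weyl_rep_z_mult: "weyl_rep q (weyl_z * a) i m = q powi (m + i) * weyl_rep q a i m"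
  by (simp add: weyl_rep_mult_hom_left[of 0])

lemma weyl_z_X: "weyl_class q (weyl_z * free_gen X) =
    weyl_class q (free_scalar q * (free_gen X * weyl_z))"
  by (rule weyl_class_eqI)
    (simp add: weyl_rep_z_mult weyl_rep_mult_hom_right[of 0] power_int_add q_nonzero)

lemma weyl_z_Y: "weyl_class q (free_gen Y * weyl_z) =
    weyl_class q (free_scalar q * (weyl_z * free_gen Y))"
  by (rule weyl_class_eqI)
    (simp add: weyl_rep_z_mult weyl_rep_mult_hom_right[of 0] power_int_diff q_nonzero)

text \<open>Because (q - 1) [m] + 1 = q^m. Under an automorphism this relation constrains the
  product of the images of x and y.\<close>

lemma weyl_z_eq: "weyl_class q weyl_z =
    weyl_class q (free_scalar (q - 1) * (free_gen X * free_gen Y) + 1)"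
  using q_neq_1
  by (intro weyl_class_eqI) (auto simp: weyl_rep_mult_hom_right[of "-1"] q_int_def)

definition z_multiple :: "(word \<Rightarrow>\<^sub>0 'k) \<Rightarrow> bool"
  where "z_multiple p \<longleftrightarrow> (\<exists>v. weyl_class q p = weyl_class q (weyl_z * v))"

lemma z_multiple_add: "z_multiple a \<Longrightarrow> z_multiple b \<Longrightarrow> z_multiple (a + b)"
  unfolding z_multiple_def by (metis distrib_left weyl_class_add)

lemma z_multiple_mult_right: "z_multiple a \<Longrightarrow> z_multiple (a * b)"
  unfolding z_multiple_def by (metis mult.assoc weyl_class_mult)

text \<open>Normality of z: each generator passes z at the cost of a scalar factor.\<close>

lemma z_multiple_mult_left:
  assumes "z_multiple a"
  shows "z_multiple (r * a)"
proof (induction r rule: free_algebra_induct)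
  case (gen g p)
  then obtain v where v: "weyl_class q (p * a) = weyl_class q (weyl_z * v)"
    by (auto simp: z_multiple_def)
  \<comment> \<open>The scalars come from xz = q^(-1) zx and yz = q zy.\<close>
  define c where "c = (case g of X \<Rightarrow> 1 / q | Y \<Rightarrow> q)"
  have "weyl_class q (free_gen g * weyl_z) =
      weyl_class q (weyl_z * (free_scalar c * free_gen g))"
    by (rule weyl_class_eqI, cases g)
      (simp_all add: c_def weyl_rep_z_mult weyl_rep_mult_hom_right[of 0] power_int_add
        power_int_diff q_nonzero)
  then have "weyl_class q (free_gen g * (p * a)) =
      weyl_class q (weyl_z * ((free_scalar c * free_gen g) * v))"
    by (metis v mult.assoc weyl_class_mult)
  then show ?case unfolding z_multiple_def by (metis mult.assoc)
next
  case (scalar c p)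
  then obtain v where v: "weyl_class q (p * a) = weyl_class q (weyl_z * v)"
    by (auto simp: z_multiple_def)
  then have "weyl_class q (free_scalar c * p * a) = weyl_class q (weyl_z * (free_scalar c * v))"
    by (simp add: mult.assoc free_scalar_central_left weyl_class_smult)
  then show ?case unfolding z_multiple_def by blast
qed (simp_all add: assms distrib_right z_multiple_add)

text \<open>
  The quotient by the normal element z is commutative, so z generates the commutator ideal,
  which every automorphism preserves.
\<close>

lemma z_multiple_commutator: "z_multiple (a * b - b * a)"
proof -
  have zero: "z_multiple 0"
    unfolding z_multiple_def by (rule exI[of _ 0]) simp
  have gens: "z_multiple (free_gen g * free_gen g' - free_gen g' * free_gen g)" for g g'
  proof -
    have "z_multiple weyl_z" "z_multiple (- weyl_z)"
      unfolding z_multiple_def by (metis mult_1_right, metis mult_minus1_right)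
    then show ?thesis by (cases g; cases g') (simp_all add: weyl_z_def zero)
  qed
  \<comment> \<open>First \<open>b\<close> varies against a fixed generator, afterwards
    \<open>a\<close> varies. Both inductions use that the commutator is a derivation in each
    argument.\<close>
  have gen: "z_multiple (free_gen g * b - b * free_gen g)" for g b
  proof (induction b rule: free_algebra_induct)
    case (gen g' p)
    have "free_gen g * (free_gen g' * p) - free_gen g' * p * free_gen g =
        (free_gen g * free_gen g' - free_gen g' * free_gen g) * p +
        free_gen g' * (free_gen g * p - p * free_gen g)"
      by (simp add: algebra_simps)
    then show ?case
      using gen gens by (simp add: z_multiple_add z_multiple_mult_left z_multiple_mult_right)
  next
    case (add p p')
    have "free_gen g * (p + p') - (p + p') * free_gen g =
        (free_gen g * p - p * free_gen g) + (free_gen g * p' - p' * free_gen g)"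
      by (simp add: algebra_simps)
    with add show ?case by (simp add: z_multiple_add)
  next
    case (scalar c p)
    have "free_gen g * (free_scalar c * p) - free_scalar c * p * free_gen g =
        free_scalar c * (free_gen g * p - p * free_gen g)"
      by (simp add: free_scalar_central_left algebra_simps)
    with scalar show ?case by (simp add: z_multiple_mult_left)
  qed (simp add: zero)
  show ?thesis
  proof (induction a rule: free_algebra_induct)
    case (gen g p)
    have "free_gen g * p * b - b * (free_gen g * p) =
        free_gen g * (p * b - b * p) + (free_gen g * b - b * free_gen g) * p"
      by (simp add: algebra_simps)
    then show ?case
      using gen \<open>\<And>g b. z_multiple (free_gen g * b - b * free_gen g)\<close>
      by (simp add: z_multiple_add z_multiple_mult_left z_multiple_mult_right)
  next
    case (add p p')
    have "(p + p') * b - b * (p + p') = (p * b - b * p) + (p' * b - b * p')"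
      by (simp add: algebra_simps)
    with add show ?case by (simp add: z_multiple_add)
  next
    case (scalar c p)
    have "free_scalar c * p * b - b * (free_scalar c * p) = free_scalar c * (p * b - b * p)"
      by (simp add: free_scalar_central_left algebra_simps)
    with scalar show ?case by (simp add: z_multiple_mult_left)
  qed (simp add: zero)
qed


section \<open>Automorphisms\<close>

text \<open>The two factors could vanish at complementary values of m. As polynomials in q^m they
  cannot: a product vanishing at all powers of q is zero, and the polynomial ring has no zero
  divisors.\<close>

lemma weyl_rep_zero_free:
  assumes "weyl_rep q a i \<noteq> (\<lambda>m. 0)" "weyl_rep q b j \<noteq> (\<lambda>m. 0)"
  shows "\<exists>m. weyl_rep q a i (m + j) * weyl_rep q b j m \<noteq> 0"
proof (rule ccontr)
  assume *: "\<nexists>m. weyl_rep q a i (m + j) * weyl_rep q b j m \<noteq> 0"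
  obtain g where g: "\<And>m. weyl_rep q a i (m + j) = poly g (q powi m)"
    using weyl_rep_shift_polynomial by blast
  obtain h where h: "\<And>m. weyl_rep q b j m = poly h (q powi m)"
    using weyl_rep_polynomial[OF q_nonzero] by blast
  have "g * h = 0" by (rule poly_eqI_q_powi) (use * in \<open>simp add: g h\<close>)
  then consider "g = 0" | "h = 0" by auto
  then show False
  proof cases
    case 1
    have "weyl_rep q a i m = 0" for m using g[of "m - j"] 1 by simp
    with assms(1) show False by auto
  next
    case 2
    with h assms(2) show False by auto
  qed
qed

text \<open>
  Comparing the extreme weights of u and v shows that a unit is homogeneous; it has weight 0
  since in nonzero weight u or v would not preserve the span of the nonnegative powers of t.
\<close>

lemma weyl_rep_unit:
  assumes "weyl_rep q (u * v) = weyl_rep q 1"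
  obtains c where "c \<noteq> 0" "\<And>i m. weyl_rep q u i m = (if i = 0 then c else 0)"
proof -
  define W where "W p = {j. \<exists>m. weyl_rep q p j m \<noteq> 0}" for p
  have fin: "finite (W p)" for p unfolding W_def by (rule finite_weights)
  have zero: "weyl_rep q p j m = 0" if "j \<notin> W p" for p j m
    using that by (simp add: W_def)
  have nz: "weyl_rep q p j \<noteq> (\<lambda>m. 0)" if "j \<in> W p" for p j
    using that by (auto simp: W_def)
  have one: "weyl_rep q (u * v) i m = (if i = 0 then 1 else 0)" for i m
    using assms by simp
  have ne: "W u \<noteq> {}" "W v \<noteq> {}"
    using one[of 0 0] weyl_rep_mult[of "{}" q v 0 u 0] zero by force+
  \<comment> \<open>A weight of the product that is reached by a single pair of weights carries a
    nonzero component, while uv = 1 lives in weight 0 only.\<close>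
  have extreme: "i + j = 0"
    if "i \<in> W u" "j \<in> W v" "\<And>k. k \<in> W v \<Longrightarrow> i + j - k \<in> W u \<Longrightarrow> k = j" for i j
  proof -
    have "weyl_rep q (u * v) (i + j) m = weyl_rep q u i (m + j) * weyl_rep q v j m" for m
      by (subst weyl_rep_mult[of "{j}"]) (use that(3) zero in auto)
    moreover have "\<exists>m. weyl_rep q u i (m + j) * weyl_rep q v j m \<noteq> 0"
      using that by (intro weyl_rep_zero_free nz)
    ultimately show ?thesis using one[of "i + j"] by metis
  qed
  define d where "d = Max (W u)"
  have "Max (W u) + Max (W v) = 0"
  proof (rule extreme)
    fix k assume k: "k \<in> W v" "Max (W u) + Max (W v) - k \<in> W u"
    have "Max (W u) + Max (W v) - k \<le> Max (W u)" "k \<le> Max (W v)"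
      using k fin by simp_all
    then show "k = Max (W v)" by simp
  qed (use fin ne in simp_all)
  moreover have "Min (W u) + Min (W v) = 0"
  proof (rule extreme)
    fix k assume k: "k \<in> W v" "Min (W u) + Min (W v) - k \<in> W u"
    have "Min (W u) \<le> Min (W u) + Min (W v) - k" "Min (W v) \<le> k"
      using k fin by simp_all
    then show "k = Min (W v)" by simp
  qed (use fin ne in simp_all)
  moreover have "Min (W u) \<le> Max (W u)" "Min (W v) \<le> Max (W v)"
    using fin ne by simp_all
  \<comment> \<open>The widths Max - Min of the two supports are nonnegative and add up to 0, so
    each support is a single weight.\<close>
  ultimately have d: "Min (W u) = d" "Max (W u) = d" "Max (W v) = - d"
    by (simp_all add: d_def)
  have u: "weyl_rep q u i m = 0" if "i \<noteq> d" for i m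
  proof (rule zero)
    show "i \<notin> W u"
      using that d Min_le[OF fin, of i u] Max_ge[OF fin, of i u] by auto
  qed
  have uv: "weyl_rep q u d (m - d) * weyl_rep q v (- d) m = 1" for m
    using one[of 0 m] weyl_rep_mult_hom_left[of d q u v 0 m] u by simp
  have "d = 0"
  proof (rule ccontr)
    assume "d \<noteq> 0"
    then consider "d > 0" | "d < 0" by linarith
    then show False
    proof cases
      case 1
      then show False using uv[of 0] weyl_rep_preserves_nonneg[of 0 "- d" q v] by simp
    next
      case 2
      \<comment> \<open>At m = d the factor of u is evaluated on t^0, which weight d < 0 would send
        to a negative exponent.\<close>
      then show False using uv[of d] weyl_rep_preserves_nonneg[of 0 d q u] by simp
    qed
  qed
  obtain g where g: "\<And>m. weyl_rep q u 0 m = poly g (q powi m)"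
    using weyl_rep_polynomial[OF q_nonzero] by blast
  obtain h where h: "\<And>m. weyl_rep q v 0 m = poly h (q powi m)"
    using weyl_rep_polynomial[OF q_nonzero] by blast
  \<comment> \<open>In weight 0 the two actions are mutually inverse polynomials in q^m, so both are
    constant.\<close>
  have "g * h = 1"
    by (rule poly_eqI_q_powi) (use uv \<open>d = 0\<close> in \<open>simp add: g h\<close>)
  then have "g dvd 1" "g \<noteq> 0" by (metis dvd_triv_left, auto)
  then have "degree g = 0" by (simp add: is_unit_iff_degree)
  then obtain c where "g = [:c:]" by (rule degree_eq_zeroE)
  moreover with \<open>g \<noteq> 0\<close> have "c \<noteq> 0" by simp
  ultimately show thesis using that[of c] u \<open>d = 0\<close> g by simp
qed

lemma weyl_automorphism_form:
  assumes "weyl_automorphism q \<rho>"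
  obtains c where "c \<noteq> 0" "\<rho> (weyl_x q) = weyl_smult q c (weyl_x q)"
    "\<rho> (weyl_y q) = weyl_smult q (inverse c) (weyl_y q)"
proof -
  let ?cl = "weyl_class q"
  have iso: "\<rho> \<in> ring_hom (qweyl q) (qweyl q)"
    "bij_betw \<rho> (carrier (qweyl q)) (carrier (qweyl q))"
    and lin: "\<And>a s. a \<in> carrier (qweyl q) \<Longrightarrow> \<rho> (weyl_smult q s a) = weyl_smult q s (\<rho> a)"
    using assms by (auto simp: weyl_automorphism_def ring_iso_def weyl_linear_def)
  have closed: "\<rho> a \<in> carrier (qweyl q)" if "a \<in> carrier (qweyl q)" for a
    using iso(1) that by (rule ring_hom_closed)
  have "\<exists>p'. \<rho> (?cl p) = ?cl p'" for p
    using closed[OF weyl_class_closed] by (metis weyl_class_cases)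
  \<comment> \<open>\<open>r\<close> is an arbitrary choice of representatives for the images, so it
    respects the operations only up to classes.\<close>
  then obtain r where r: "\<And>p. \<rho> (?cl p) = ?cl (r p)" by metis
  have r_mult: "?cl (r (a * b)) = ?cl (r a * r b)" for a b
    unfolding weyl_class_mult r[symmetric] by (rule ring_hom_mult[OF iso(1)]) simp_all
  have r_add: "?cl (r (a + b)) = ?cl (r a + r b)" for a b
    unfolding weyl_class_add r[symmetric] by (rule ring_hom_add[OF iso(1)]) simp_all
  have r_one: "?cl (r 1) = ?cl 1"
    unfolding r[symmetric] weyl_class_one by (rule ring_hom_one[OF iso(1)])
  have r_scalar: "?cl (r (free_scalar s * a)) = ?cl (free_scalar s * r a)" for s a
    unfolding weyl_class_smult r[symmetric] by (rule lin) simp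
  have r_scalar_mult: "?cl (r (free_scalar s * (a * b))) = ?cl (free_scalar s * (r a * r b))"
    for s a b using r_scalar[of s "a * b"] r_mult[of a b] by (simp only: weyl_class_smult)
  have r_cong: "?cl (r a) = ?cl (r b)" if "?cl a = ?cl b" for a b
    unfolding r[symmetric] that by (rule refl)
  have r_diff: "?cl (r (a - b)) = ?cl (r a - r b)" for a b
    using r_add[of "a - b" b] by (simp add: weyl_class_eq_iff fun_eq_iff)
  have r_surj: "\<exists>b. ?cl (r b) = ?cl a" for a
  proof -
    have "?cl a \<in> \<rho> ` carrier (qweyl q)"
      using iso(2) by (simp add: bij_betw_imp_surj_on)
    then show ?thesis by (metis imageE r weyl_class_cases)
  qed
  let ?x = "r (free_gen X)" and ?y = "r (free_gen Y)"
  have r_z: "?cl (r weyl_z) = ?cl (?y * ?x - ?x * ?y)"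
    unfolding weyl_z_def r_diff by (simp add: weyl_class_minus r_mult)
  then obtain u where u: "?cl (r weyl_z) = ?cl (weyl_z * u)"
    using z_multiple_commutator[of ?y ?x] by (auto simp: z_multiple_def)
  \<comment> \<open>Preimages of x and y exhibit z as the image of a commutator, that is of some zw.
    This gives z = z u r(w), and cancelling z makes u a unit.\<close>
  obtain a b where ab: "?cl (r a) = ?cl (free_gen X)" "?cl (r b) = ?cl (free_gen Y)"
    using r_surj by blast
  obtain w where w: "?cl (b * a - a * b) = ?cl (weyl_z * w)"
    using z_multiple_commutator[of b a] by (auto simp: z_multiple_def)
  have "?cl weyl_z = ?cl (r (b * a - a * b))"
    by (simp add: weyl_z_def r_diff weyl_class_minus r_mult weyl_class_mult ab)
  also have "\<dots> = ?cl (weyl_z * (u * r w))"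
    using r_cong[OF w] u by (simp add: r_mult weyl_class_mult flip: mult.assoc)
  finally have "weyl_rep q weyl_z i m = weyl_rep q (weyl_z * (u * r w)) i m" for i m
    by (simp add: weyl_class_eq_iff)
  then have "(if i = 0 then q powi m else 0) = q powi (m + i) * weyl_rep q (u * r w) i m" for i m
    by (simp add: weyl_rep_z_mult)
  note uw = this
  have "weyl_rep q (u * r w) i m = weyl_rep q 1 i m" for i m
    using uw[of i m] q_nonzero by (cases "i = 0") simp_all
  then have "weyl_rep q (u * r w) = weyl_rep q 1" by (simp add: fun_eq_iff)
  then obtain l where l: "l \<noteq> 0" "\<And>i m. weyl_rep q u i m = (if i = 0 then l else 0)"
    by (rule weyl_rep_unit) blast
  have rz: "weyl_rep q (r weyl_z) i m = (if i = 0 then l * q powi m else 0)" for i m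
    using u l(2) by (simp add: weyl_class_eq_iff weyl_rep_z_mult)
  \<comment> \<open>The image of z acts by l q^m. In weight i the image of zx = q xz therefore
    leaves the factor q^i - q, which vanishes only for i = 1; the image of y is treated
    likewise.\<close>
  have x_hom: "weyl_rep q ?x i m = 0" if "i \<noteq> 1" for i m
  proof -
    have "?cl (r weyl_z * ?x) = ?cl (free_scalar q * (?x * r weyl_z))"
      using r_cong[OF weyl_z_X] by (simp only: r_mult[of weyl_z] r_scalar_mult)
    then have "weyl_rep q (r weyl_z * ?x) i m = weyl_rep q (free_scalar q * (?x * r weyl_z)) i m"
      by (simp add: weyl_class_eq_iff)
    then have "l * q powi m * weyl_rep q ?x i m * (q powi i - q powi 1) = 0"
      using rz q_nonzero
      by (simp add: weyl_rep_mult_hom_left[of 0 q "r weyl_z"] weyl_rep_mult_hom_right[of 0 q "r weyl_z"]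
          power_int_add algebra_simps)
    then show ?thesis
      using l(1) q_nonzero that q_powi_eq_iff[of i 1] by simp
  qed
  have y_hom: "weyl_rep q ?y i m = 0" if "i \<noteq> -1" for i m
  proof -
    have "?cl (?y * r weyl_z) = ?cl (free_scalar q * (r weyl_z * ?y))"
      using r_cong[OF weyl_z_Y] by (simp only: r_mult[of _ weyl_z] r_scalar_mult)
    then have "weyl_rep q (?y * r weyl_z) i m = weyl_rep q (free_scalar q * (r weyl_z * ?y)) i m"
      by (simp add: weyl_class_eq_iff)
    then have "l * q powi m * weyl_rep q ?y i m * (q powi (i + 1) - 1) = 0"
      using rz q_nonzero
      by (simp add: weyl_rep_mult_hom_left[of 0 q "r weyl_z"] weyl_rep_mult_hom_right[of 0 q "r weyl_z"]
          power_int_add algebra_simps)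
    then show ?thesis
      using l(1) q_nonzero that q_powi_eq_1_iff[of "i + 1"] by simp
  qed
  have prod: "l * q powi m =
      (q - 1) * (weyl_rep q ?x 1 (m - 1) * weyl_rep q ?y (- 1) m) + 1" for m
  proof -
    have "?cl (r weyl_z) = ?cl (free_scalar (q - 1) * (?x * ?y) + 1)"
      using r_cong[OF weyl_z_eq] by (simp only: weyl_class_add r_add r_scalar_mult r_one)
    then have "weyl_rep q (r weyl_z) 0 m = weyl_rep q (free_scalar (q - 1) * (?x * ?y) + 1) 0 m"
      by (simp add: weyl_class_eq_iff)
    then show ?thesis
      using rz y_hom by (simp add: weyl_rep_mult_hom_right[of "-1" q ?y])
  qed
  \<comment> \<open>Weight -1 would lead from t^0 to a negative exponent. The product relation at m
    = 0 then gives l = 1.\<close>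
  have y0: "weyl_rep q ?y (- 1) 0 = 0" by (rule weyl_rep_preserves_nonneg) simp_all
  with prod[of 0] have "l = 1" by simp
  obtain g where g: "\<And>m. weyl_rep q ?x 1 (m - 1) = poly g (q powi m)"
    using weyl_rep_shift_polynomial[of ?x 1 "-1"] by auto
  obtain h where h: "\<And>m. weyl_rep q ?y (- 1) m = poly h (q powi m)"
    using weyl_rep_polynomial[OF q_nonzero] by blast
  \<comment> \<open>With T for q^m this says (q - 1) g h = T - 1, so one factor is linear and the
    other constant. The shift to m - 1 in \<open>g\<close> accounts for y acting first.\<close>
  have gh: "smult (q - 1) (g * h) = [:-1, 1:]"
    by (rule poly_eqI_q_powi) (use prod \<open>l = 1\<close> in \<open>simp add: g h algebra_simps\<close>)
  have "q - 1 \<noteq> 0" using q_neq_1 by simp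
  have "g \<noteq> 0" "h \<noteq> 0" using gh by auto
  have "degree (smult (q - 1) (g * h)) = 1" by (simp add: gh)
  then have "degree g + degree h = 1"
    using \<open>q - 1 \<noteq> 0\<close> \<open>g \<noteq> 0\<close> \<open>h \<noteq> 0\<close> by (simp add: degree_mult_eq)
  \<comment> \<open>\<open>y0\<close> makes q^0 = 1 a root of the nonzero polynomial
    \<open>h\<close>, so \<open>h\<close> is the linear factor and \<open>g\<close> the constant
    one.\<close>
  moreover have "degree h \<noteq> 0"
  proof
    assume "degree h = 0"
    then obtain s where "h = [:s:]" by (rule degree_eq_zeroE)
    with y0 h[of 0] \<open>h \<noteq> 0\<close> show False by simp
  qed
  ultimately have "degree g = 0" by linarith
  then obtain c where c: "g = [:c:]" by (rule degree_eq_zeroE)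
  with \<open>g \<noteq> 0\<close> have "c \<noteq> 0" by simp
  have x1: "weyl_rep q ?x 1 m = c" for m using g[of "m + 1"] c by simp
  have y1: "weyl_rep q ?y (- 1) m = inverse c * q_int q m" for m
    using prod[of m] \<open>c \<noteq> 0\<close> \<open>q - 1 \<noteq> 0\<close> \<open>l = 1\<close> by (simp add: x1 q_int_def field_simps)
  have "?cl ?x = ?cl (free_scalar c * free_gen X)"
    by (rule weyl_class_eqI) (use x_hom x1 in simp)
  moreover have "?cl ?y = ?cl (free_scalar (inverse c) * free_gen Y)"
    by (rule weyl_class_eqI) (use y_hom y1 in simp)
  ultimately show thesis
    using that[OF \<open>c \<noteq> 0\<close>] by (simp add: weyl_x_def weyl_y_def r weyl_class_smult)
qed

end


section \<open>Skew derivations\<close>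

lemma weyl_x_closed [simp]: "weyl_x q \<in> carrier (qweyl q)"
  and weyl_y_closed [simp]: "weyl_y q \<in> carrier (qweyl q)"
  by (simp_all add: weyl_x_def weyl_y_def)

text \<open>x and y generate the quotient as an algebra, so two maps compatible with the operations
  need only be compared on them.\<close>

lemma qweyl_induct [consumes 1, case_names one x y add mult smult]:
  assumes "a \<in> carrier (qweyl q)"
    and "P \<one>\<^bsub>qweyl q\<^esub>" "P (weyl_x q)" "P (weyl_y q)"
    and "\<And>a b. a \<in> carrier (qweyl q) \<Longrightarrow> b \<in> carrier (qweyl q) \<Longrightarrow> P a \<Longrightarrow> P b \<Longrightarrow>
      P (a \<oplus>\<^bsub>qweyl q\<^esub> b)"
    and "\<And>a b. a \<in> carrier (qweyl q) \<Longrightarrow> b \<in> carrier (qweyl q) \<Longrightarrow> P a \<Longrightarrow> P b \<Longrightarrow>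
      P (a \<otimes>\<^bsub>qweyl q\<^esub> b)"
    and "\<And>c a. a \<in> carrier (qweyl q) \<Longrightarrow> P a \<Longrightarrow> P (weyl_smult q c a)"
  shows "P a"
proof -
  obtain p where "a = weyl_class q p" using assms(1) by (rule weyl_class_cases)
  moreover have "P (weyl_class q p)"
  proof (induction p rule: free_algebra_induct)
    case (gen g p)
    have "P (weyl_class q (free_gen g))"
      using assms(3,4) by (cases g) (simp_all add: weyl_x_def weyl_y_def)
    with gen show ?case by (simp add: weyl_class_mult assms(6))
  qed (simp_all add: assms weyl_class_one weyl_class_add weyl_class_smult)
  ultimately show ?thesis by simp
qed

section \<open>Scalar multiplication and polynomials in the quotient\<close>

lemma weyl_smult_closed [simp]:
  "a \<in> carrier (qweyl q) \<Longrightarrow> weyl_smult q c a \<in> carrier (qweyl q)"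
  by (metis weyl_class_cases weyl_class_closed weyl_class_smult)

lemma weyl_smult_smult:
  "a \<in> carrier (qweyl q) \<Longrightarrow> weyl_smult q c (weyl_smult q d a) = weyl_smult q (c * d) a"
  by (elim weyl_class_cases) (simp add: free_scalar_mult_left flip: weyl_class_smult)

lemma weyl_smult_mult_left:
  assumes "a \<in> carrier (qweyl q)" "b \<in> carrier (qweyl q)"
  shows "weyl_smult q c a \<otimes>\<^bsub>qweyl q\<^esub> b = weyl_smult q c (a \<otimes>\<^bsub>qweyl q\<^esub> b)"
  using assms
  by (elim weyl_class_cases) (simp add: mult.assoc flip: weyl_class_smult weyl_class_mult)

lemma weyl_smult_mult_right:
  assumes "a \<in> carrier (qweyl q)" "b \<in> carrier (qweyl q)"
  shows "a \<otimes>\<^bsub>qweyl q\<^esub> weyl_smult q c b = weyl_smult q c (a \<otimes>\<^bsub>qweyl q\<^esub> b)"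
  using assms
  by (elim weyl_class_cases)
    (simp add: free_scalar_central_left flip: weyl_class_smult weyl_class_mult)

lemma weyl_smult_one:
  "a \<in> carrier (qweyl q) \<Longrightarrow> weyl_smult q 1 a = a"
  by (elim weyl_class_cases) (simp flip: weyl_class_smult)

lemma weyl_automorphism_ring_hom_ring:
  assumes "weyl_automorphism q \<rho>"
  shows "ring_hom_ring (qweyl q) (qweyl q) \<rho>"
  using assms ring_qweyl
  by (auto simp: weyl_automorphism_def ring_iso_def intro: ring_hom_ringI2)

lemma weyl_automorphism_smult:
  "weyl_automorphism q \<rho> \<Longrightarrow> a \<in> carrier (qweyl q) \<Longrightarrow>
    \<rho> (weyl_smult q c a) = weyl_smult q c (\<rho> a)"
  by (auto simp: weyl_automorphism_def weyl_linear_def)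

lemma weyl_poly_closed [simp]:
  assumes "a \<in> carrier (qweyl q)"
  shows "weyl_poly q f a \<in> carrier (qweyl q)"
proof -
  interpret R: ring "qweyl q" by (rule ring_qweyl)
  show ?thesis using assms by (simp add: weyl_poly_def R.finsum_closed)
qed

lemma weyl_automorphism_fixes_poly:
  assumes "weyl_automorphism q \<rho>" "a \<in> carrier (qweyl q)" "\<rho> a = a"
  shows "\<rho> (weyl_poly q f a) = weyl_poly q f a"
proof -
  interpret H: ring_hom_ring "qweyl q" "qweyl q" \<rho>
    by (rule weyl_automorphism_ring_hom_ring[OF assms(1)])
  have "\<rho> (a [^]\<^bsub>qweyl q\<^esub> n) = a [^]\<^bsub>qweyl q\<^esub> n" for n :: nat
    by (induction n) (simp_all add: assms)
  \<comment> \<open>The upper limit is freed from \<open>degree f\<close> to allow induction on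
    it.\<close>
  then have "\<rho> (\<Oplus>\<^bsub>qweyl q\<^esub> i\<in>{..n}. weyl_smult q (coeff f i) (a [^]\<^bsub>qweyl q\<^esub> i)) =
    (\<Oplus>\<^bsub>qweyl q\<^esub> i\<in>{..n}. weyl_smult q (coeff f i) (a [^]\<^bsub>qweyl q\<^esub> i))" for n
    using assms(2,3)
    by (induction n) (simp_all add: weyl_automorphism_smult[OF assms(1)] Pi_def)
  then show ?thesis by (simp add: weyl_poly_def)
qed

theorem proposition3:
  fixes q \<mu> :: "'k::{alg_closed_field, field_char_0}"
    and f :: "'k poly"
    and \<sigma> \<delta> \<rho> :: "(word \<Rightarrow>\<^sub>0 'k) set \<Rightarrow> (word \<Rightarrow>\<^sub>0 'k) set"
  assumes "q \<noteq> 0" and "\<And>n::nat. n > 0 \<Longrightarrow> q ^ n \<noteq> 1"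
    and "\<mu> \<noteq> 0"
    and "weyl_automorphism q \<sigma>"
    and "\<sigma> (weyl_x q) = weyl_smult q (inverse \<mu>) (weyl_x q)"
    and "\<sigma> (weyl_y q) = weyl_smult q \<mu> (weyl_y q)"
    and "weyl_skew_derivation q \<sigma> \<delta>"
    and "\<delta> (weyl_x q) = weyl_poly q f (weyl_h q) \<otimes>\<^bsub>qweyl q\<^esub> weyl_x q"
    and "\<delta> (weyl_y q) =
      weyl_smult q (inverse \<mu>)
        (weyl_poly q f (weyl_smult q (inverse q) (weyl_h q)) \<otimes>\<^bsub>qweyl q\<^esub> weyl_y q)"
    and "weyl_automorphism q \<rho>"
  shows "\<forall>a\<in>carrier (qweyl q). \<delta> (\<rho> a) = \<rho> (\<delta> a)"
proof -
  interpret generic_q q by unfold_locales (fact assms)+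
  interpret \<rho>: ring_hom_ring "qweyl q" "qweyl q" \<rho>
    by (rule weyl_automorphism_ring_hom_ring[OF assms(10)])
  interpret \<sigma>: ring_hom_ring "qweyl q" "qweyl q" \<sigma>
    by (rule weyl_automorphism_ring_hom_ring[OF assms(4)])
  note \<rho>_smult = weyl_automorphism_smult[OF assms(10)]
  note \<sigma>_smult = weyl_automorphism_smult[OF assms(4)]
  have \<delta>_closed: "\<delta> a \<in> carrier (qweyl q)"
    and \<delta>_smult: "\<delta> (weyl_smult q c a) = weyl_smult q c (\<delta> a)"
    if "a \<in> carrier (qweyl q)" for a c
    using assms(7) that by (auto simp: weyl_skew_derivation_def weyl_linear_def)
  have \<delta>_add: "\<delta> (a \<oplus>\<^bsub>qweyl q\<^esub> b) = \<delta> a \<oplus>\<^bsub>qweyl q\<^esub> \<delta> b"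
    and \<delta>_mult: "\<delta> (a \<otimes>\<^bsub>qweyl q\<^esub> b) =
      (\<delta> a \<otimes>\<^bsub>qweyl q\<^esub> b) \<oplus>\<^bsub>qweyl q\<^esub> (\<sigma> a \<otimes>\<^bsub>qweyl q\<^esub> \<delta> b)"
    if "a \<in> carrier (qweyl q)" "b \<in> carrier (qweyl q)" for a b
    using assms(7) that by (auto simp: weyl_skew_derivation_def weyl_linear_def)
  obtain c where c: "c \<noteq> 0" "\<rho> (weyl_x q) = weyl_smult q c (weyl_x q)"
    "\<rho> (weyl_y q) = weyl_smult q (inverse c) (weyl_y q)"
    using weyl_automorphism_form[OF assms(10)] .
  have h_closed: "weyl_h q \<in> carrier (qweyl q)"
    by (simp add: weyl_h_def)
  \<comment> \<open>The scalars c^(-1) and c cancel in the product.\<close>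
  have "\<rho> (weyl_y q \<otimes>\<^bsub>qweyl q\<^esub> weyl_x q) = weyl_y q \<otimes>\<^bsub>qweyl q\<^esub> weyl_x q"
    using c by (simp add: weyl_smult_mult_left weyl_smult_mult_right weyl_smult_smult weyl_smult_one)
  then have "\<rho> (weyl_h q) = weyl_h q"
    by (simp add: weyl_h_def \<rho>.R.minus_eq)
  \<comment> \<open>The free scalar covers both polynomials: s = 1 for \<delta>(x) and s = q^(-1)
    for \<delta>(y).\<close>
  then have \<rho>_poly: "\<rho> (weyl_poly q f (weyl_smult q s (weyl_h q))) =
      weyl_poly q f (weyl_smult q s (weyl_h q))" for s
    using h_closed by (intro weyl_automorphism_fixes_poly[OF assms(10)]) (simp_all add: \<rho>_smult)
  \<comment> \<open>Both automorphisms only rescale x and y. This is what matches the twisted terms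
    \<sigma>(a) \<delta>(b) when \<delta> and \<rho> are compared on a product.\<close>
  have \<sigma>\<rho>: "\<sigma> (\<rho> a) = \<rho> (\<sigma> a)" if "a \<in> carrier (qweyl q)" for a
    using that
  proof (induction rule: qweyl_induct)
  qed (simp_all add: c assms(5,6) \<rho>_smult \<sigma>_smult weyl_smult_smult mult.commute)
  \<comment> \<open>The skew Leibniz rule on 1 times 1, with \<sigma>(1) = 1.\<close>
  have "\<delta> \<one>\<^bsub>qweyl q\<^esub> = \<delta> \<one>\<^bsub>qweyl q\<^esub> \<oplus>\<^bsub>qweyl q\<^esub> \<delta> \<one>\<^bsub>qweyl q\<^esub>"
    using \<delta>_mult[of "\<one>\<^bsub>qweyl q\<^esub>" "\<one>\<^bsub>qweyl q\<^esub>"] \<delta>_closed by simp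
  then have \<delta>_one: "\<delta> \<one>\<^bsub>qweyl q\<^esub> = \<zero>\<^bsub>qweyl q\<^esub>"
    using \<delta>_closed by (metis \<rho>.R.add.l_cancel_one' \<rho>.R.one_closed)
  have "\<delta> (\<rho> a) = \<rho> (\<delta> a)" if "a \<in> carrier (qweyl q)" for a
    using that
  proof (induction rule: qweyl_induct)
    case one
    show ?case by (simp add: \<delta>_one)
  next
    case x
    \<comment> \<open>Both sides are c f(h) x, because \<rho> fixes f(h) and \<delta> is
      linear.\<close>
    show ?case
      using \<rho>_poly[of 1] h_closed
      by (simp add: c assms(8) \<delta>_smult weyl_smult_mult_right weyl_smult_one)
  next
    case y
    show ?case
      using \<rho>_poly[of "inverse q"] h_closed
      by (simp add: c assms(9) \<delta>_smult \<rho>_smult weyl_smult_mult_right weyl_smult_smult mult.commute)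
  next
    case (add a b)
    then show ?case by (simp add: \<delta>_add \<delta>_closed)
  next
    case (mult a b)
    then show ?case by (simp add: \<delta>_mult \<delta>_closed \<sigma>\<rho>)
  next
    case (smult s a)
    then show ?case by (simp add: \<delta>_smult \<rho>_smult \<delta>_closed)
  qed
  then show ?thesis by blast
qed

end
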